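(* Let $K$ be an arbitrary field. There exist non-isomorphic three-dimensional metabelian non-Lie Leibniz algebras over $K$ that satisfy exactly the same polynomial identities, i.e. three-dimensional metabelian Leibniz algebras $A$ and $B$ over $K$, neither of which is a Lie algebra, with $A\not\cong B$ and $T(A)=T(B)$.
   Context: A (right) Leibniz algebra over $K$ is a (nonassociative) $K$-algebra satisfying $x(yz)=(xy)z-(xz)y$ for all $x,y,z$. It is metabelian if it satisfies $(x_1x_2)(x_3x_4)=0$. Let $\mathcal L\langle X\rangle$ be the free Leibniz algebra over $K$ on $X=\{x_1,x_2,\dots\}$. For a Leibniz algebra $L$, $T(L)$ is the set of $f(x_1,\dots,x_n)\in\mathcal L\langle X\rangle$ (any $n$) with $f(a_1,\dots,a_n)=0$ for all $a_1,\dots,a_n\in L$ (the polynomial identities of $L$). *)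

theory Defs
  imports "HOL-Analysis.Analysis" "HOL-Library.Poly_Mapping"
begin

section \<open>Nonassociative algebras over a field\<close>

locale nonassoc_algebra = vector_space smul
  for smul :: "'k::field \<Rightarrow> 'a::ab_group_add \<Rightarrow> 'a" +
  fixes mul :: "'a \<Rightarrow> 'a \<Rightarrow> 'a"
  assumes mult_add_left: "mul (x + y) z = mul x z + mul y z"
    and mult_add_right: "mul x (y + z) = mul x y + mul x z"
    and mult_scale_left: "mul (smul c x) y = smul c (mul x y)"
    and mult_scale_right: "mul x (smul c y) = smul c (mul x y)"

locale leibniz_algebra = nonassoc_algebra smul mul
  for smul :: "'k::field \<Rightarrow> 'a::ab_group_add \<Rightarrow> 'a" and mul +
  assumes leibniz: "mul x (mul y z) = mul (mul x y) z - mul (mul x z) y"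

locale lie_algebra = nonassoc_algebra smul mul
  for smul :: "'k::field \<Rightarrow> 'a::ab_group_add \<Rightarrow> 'a" and mul +
  assumes alternating: "mul x x = 0"
    and jacobi: "mul (mul x y) z + mul (mul y z) x + mul (mul z x) y = 0"

definition metabelian :: "('a::ab_group_add \<Rightarrow> 'a \<Rightarrow> 'a) \<Rightarrow> bool" where
  "metabelian mul \<longleftrightarrow> (\<forall>x1 x2 x3 x4. mul (mul x1 x2) (mul x3 x4) = 0)"

definition algebra_hom ::
  "('k::field \<Rightarrow> 'a::ab_group_add \<Rightarrow> 'a) \<Rightarrow> ('a \<Rightarrow> 'a \<Rightarrow> 'a) \<Rightarrow>
   ('k \<Rightarrow> 'b::ab_group_add \<Rightarrow> 'b) \<Rightarrow> ('b \<Rightarrow> 'b \<Rightarrow> 'b) \<Rightarrow> ('a \<Rightarrow> 'b) \<Rightarrow> bool" where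
  "algebra_hom s1 m1 s2 m2 h \<longleftrightarrow>
     Vector_Spaces.linear s1 s2 h \<and> (\<forall>x y. h (m1 x y) = m2 (h x) (h y))"

definition algebras_isomorphic ::
  "('k::field \<Rightarrow> 'a::ab_group_add \<Rightarrow> 'a) \<Rightarrow> ('a \<Rightarrow> 'a \<Rightarrow> 'a) \<Rightarrow>
   ('k \<Rightarrow> 'b::ab_group_add \<Rightarrow> 'b) \<Rightarrow> ('b \<Rightarrow> 'b \<Rightarrow> 'b) \<Rightarrow> bool" where
  "algebras_isomorphic s1 m1 s2 m2 \<longleftrightarrow> (\<exists>h. algebra_hom s1 m1 s2 m2 h \<and> bij h)"


section \<open>The free nonassociative algebra\<close>

text \<open>Nonassociative monomials in the variables indexed by the natural numbers, and finite
  linear combinations of them. The library product of \<open>\<Rightarrow>\<^sub>0\<close> needs an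
  additive monoid of exponents, so it does not apply here.\<close>

datatype monomial = Var nat | Prod monomial monomial

type_synonym 'k nonassoc_poly = "monomial \<Rightarrow>\<^sub>0 'k"

definition na_scale :: "'k::field \<Rightarrow> 'k nonassoc_poly \<Rightarrow> 'k nonassoc_poly" where
  "na_scale c p = Poly_Mapping.map ((*) c) p"

definition na_mult :: "'k::field nonassoc_poly \<Rightarrow> 'k nonassoc_poly \<Rightarrow> 'k nonassoc_poly" where
  "na_mult p q = (\<Sum>t\<in>Poly_Mapping.keys p. \<Sum>u\<in>Poly_Mapping.keys q.
     Poly_Mapping.single (Prod t u) (Poly_Mapping.lookup p t * Poly_Mapping.lookup q u))"

primrec monomial_eval :: "('a \<Rightarrow> 'a \<Rightarrow> 'a) \<Rightarrow> (nat \<Rightarrow> 'a) \<Rightarrow> monomial \<Rightarrow> 'a" where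
  "monomial_eval mul a (Var i) = a i"
| "monomial_eval mul a (Prod t u) = mul (monomial_eval mul a t) (monomial_eval mul a u)"

definition na_eval ::
  "('k::field \<Rightarrow> 'a::ab_group_add \<Rightarrow> 'a) \<Rightarrow> ('a \<Rightarrow> 'a \<Rightarrow> 'a) \<Rightarrow> (nat \<Rightarrow> 'a) \<Rightarrow>
   'k nonassoc_poly \<Rightarrow> 'a" where
  "na_eval smul mul a p =
     (\<Sum>t\<in>Poly_Mapping.keys p. smul (Poly_Mapping.lookup p t) (monomial_eval mul a t))"

lemma lookup_na_scale [simp]:
  "Poly_Mapping.lookup (na_scale c p) t = c * Poly_Mapping.lookup p t"
  by (simp add: na_scale_def Poly_Mapping.map.rep_eq when_def)

lemma keys_na_scale_subset: "Poly_Mapping.keys (na_scale c p) \<subseteq> Poly_Mapping.keys p"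
  by (auto simp: in_keys_iff)

lemma lookup_single_if:
  "Poly_Mapping.lookup (Poly_Mapping.single k v) j = (if k = j then v else 0)"
  by (simp add: lookup_single when_def)

lemma na_mult_sum:
  assumes "finite S" "Poly_Mapping.keys p \<subseteq> S" "finite T" "Poly_Mapping.keys q \<subseteq> T"
  shows "na_mult p q = (\<Sum>t\<in>S. \<Sum>u\<in>T.
     Poly_Mapping.single (Prod t u) (Poly_Mapping.lookup p t * Poly_Mapping.lookup q u))"
proof -
  have inner: "(\<Sum>u\<in>Poly_Mapping.keys q.
      Poly_Mapping.single (Prod t u) (Poly_Mapping.lookup p t * Poly_Mapping.lookup q u)) =
    (\<Sum>u\<in>T. Poly_Mapping.single (Prod t u) (Poly_Mapping.lookup p t * Poly_Mapping.lookup q u))" for t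
    by (rule sum.mono_neutral_left) (use assms in \<open>auto simp: in_keys_iff\<close>)
  show ?thesis unfolding na_mult_def inner
    by (rule sum.mono_neutral_left) (use assms in \<open>auto simp: in_keys_iff\<close>)
qed

lemma na_eval_sum:
  assumes "vector_space smul" "finite S" "Poly_Mapping.keys p \<subseteq> S"
  shows "na_eval smul mul a p =
    (\<Sum>t\<in>S. smul (Poly_Mapping.lookup p t) (monomial_eval mul a t))"
proof -
  interpret vector_space smul by fact
  show ?thesis unfolding na_eval_def
    by (rule sum.mono_neutral_left) (use assms in \<open>auto simp: in_keys_iff\<close>)
qed

lemma na_scale_vector_space: "vector_space na_scale"
  by unfold_locales (auto intro!: poly_mapping_eqI simp: lookup_add algebra_simps)

lemma na_scale_single: "na_scale c (Poly_Mapping.single k v) = Poly_Mapping.single k (c * v)"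
  by (auto intro!: poly_mapping_eqI simp: lookup_single_if)

lemma na_mult_add_left: "na_mult (x + y) z = na_mult x z + na_mult y z"
proof -
  let ?S = "Poly_Mapping.keys x \<union> Poly_Mapping.keys y"
  have "Poly_Mapping.keys (x + y) \<subseteq> ?S" by (rule keys_add)
  then show ?thesis
    by (subst (1 2 3) na_mult_sum[where S = ?S and T = "Poly_Mapping.keys z"])
      (auto simp: lookup_add single_add distrib_right sum.distrib)
qed

lemma na_mult_add_right: "na_mult x (y + z) = na_mult x y + na_mult x z"
proof -
  let ?T = "Poly_Mapping.keys y \<union> Poly_Mapping.keys z"
  have "Poly_Mapping.keys (y + z) \<subseteq> ?T" by (rule keys_add)
  then show ?thesis
    by (subst (1 2 3) na_mult_sum[where S = "Poly_Mapping.keys x" and T = ?T])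
      (auto simp: lookup_add single_add distrib_left sum.distrib)
qed

lemma na_mult_scale_left: "na_mult (na_scale c x) y = na_scale c (na_mult x y)"
proof -
  interpret vector_space na_scale by (rule na_scale_vector_space)
  show ?thesis
    by (subst (1 2) na_mult_sum[where S = "Poly_Mapping.keys x" and T = "Poly_Mapping.keys y"])
      (use keys_na_scale_subset in \<open>auto simp: scale_sum_right na_scale_single mult.assoc\<close>)
qed

lemma na_mult_scale_right: "na_mult x (na_scale c y) = na_scale c (na_mult x y)"
proof -
  interpret vector_space na_scale by (rule na_scale_vector_space)
  show ?thesis
    by (subst (1 2) na_mult_sum[where S = "Poly_Mapping.keys x" and T = "Poly_Mapping.keys y"])
      (use keys_na_scale_subset in \<open>auto simp: scale_sum_right na_scale_single mult.left_commute\<close>)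
qed

lemma na_nonassoc_algebra: "nonassoc_algebra na_scale na_mult"
proof -
  interpret vector_space na_scale by (rule na_scale_vector_space)
  show ?thesis
    by unfold_locales
      (rule na_mult_add_left na_mult_add_right na_mult_scale_left na_mult_scale_right)+
qed

context nonassoc_algebra
begin

lemma mult_zero_left: "mul 0 x = 0"
  using mult_scale_left[of 0 0 x] by simp

lemma mult_zero_right: "mul x 0 = 0"
  using mult_scale_right[of x 0 0] by simp

lemma mult_minus_left: "mul (- x) y = - mul x y"
  using mult_scale_left[of "-1" x y] by simp

lemma mult_minus_right: "mul x (- y) = - mul x y"
  using mult_scale_right[of x "-1" y] by simp

lemma mult_diff_left: "mul (x - y) z = mul x z - mul y z"
  using mult_add_left[of x "- y" z] by (simp add: mult_minus_left)

lemma mult_diff_right: "mul x (y - z) = mul x y - mul x z"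
  using mult_add_right[of x y "- z"] by (simp add: mult_minus_right)

lemma mult_sum_left: "mul (sum f S) z = (\<Sum>t\<in>S. mul (f t) z)"
  by (induction S rule: infinite_finite_induct) (simp_all add: mult_zero_left mult_add_left)

lemma mult_sum_right: "mul z (sum f S) = (\<Sum>t\<in>S. mul z (f t))"
  by (induction S rule: infinite_finite_induct) (simp_all add: mult_zero_right mult_add_right)

lemma na_eval_add: "na_eval smul mul a (p + q) = na_eval smul mul a p + na_eval smul mul a q"
proof -
  let ?S = "Poly_Mapping.keys p \<union> Poly_Mapping.keys q"
  have "Poly_Mapping.keys (p + q) \<subseteq> ?S" by (rule keys_add)
  then show ?thesis
    by (subst (1 2 3) na_eval_sum[where S = ?S])
      (auto simp: lookup_add scale_left_distrib sum.distrib vector_space_axioms)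
qed

lemma na_eval_scale: "na_eval smul mul a (na_scale c p) = smul c (na_eval smul mul a p)"
  by (subst (1 2) na_eval_sum[where S = "Poly_Mapping.keys p"])
    (use keys_na_scale_subset in \<open>auto simp: scale_sum_right vector_space_axioms\<close>)

lemma na_eval_single:
  "na_eval smul mul a (Poly_Mapping.single t c) = smul c (monomial_eval mul a t)"
  by (subst na_eval_sum[where S = "{t}"]) (auto simp: vector_space_axioms)

lemma na_eval_zero: "na_eval smul mul a 0 = 0"
  by (simp add: na_eval_def)

lemma na_eval_uminus: "na_eval smul mul a (- p) = - na_eval smul mul a p"
  using na_eval_add[of a p "- p"] by (simp add: na_eval_zero add_eq_0_iff)

lemma na_eval_diff: "na_eval smul mul a (p - q) = na_eval smul mul a p - na_eval smul mul a q"
  using na_eval_add[of a p "- q"] by (simp add: na_eval_uminus)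

lemma na_eval_sum_distrib: "na_eval smul mul a (sum f S) = (\<Sum>t\<in>S. na_eval smul mul a (f t))"
  by (induction S rule: infinite_finite_induct) (simp_all add: na_eval_zero na_eval_add)

lemma na_eval_mult:
  "na_eval smul mul a (na_mult p q) = mul (na_eval smul mul a p) (na_eval smul mul a q)"
  unfolding na_mult_def na_eval_sum_distrib na_eval_single
  unfolding na_eval_def mult_sum_left
  by (simp add: mult_sum_right mult_scale_left mult_scale_right mult.commute)

end


section \<open>The free Leibniz algebra\<close>

inductive_set leibniz_ideal :: "('k::field) nonassoc_poly set" where
  generator: "na_mult p (na_mult q r) - (na_mult (na_mult p q) r - na_mult (na_mult p r) q)
      \<in> leibniz_ideal"
| zero: "0 \<in> leibniz_ideal"
| add: "p \<in> leibniz_ideal \<Longrightarrow> q \<in> leibniz_ideal \<Longrightarrow> p + q \<in> leibniz_ideal"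
| scale: "p \<in> leibniz_ideal \<Longrightarrow> na_scale c p \<in> leibniz_ideal"
| mult_left: "p \<in> leibniz_ideal \<Longrightarrow> na_mult q p \<in> leibniz_ideal"
| mult_right: "p \<in> leibniz_ideal \<Longrightarrow> na_mult p q \<in> leibniz_ideal"

definition leibniz_rel :: "'k::field nonassoc_poly \<Rightarrow> 'k nonassoc_poly \<Rightarrow> bool" where
  "leibniz_rel p q \<longleftrightarrow> p - q \<in> leibniz_ideal"

lemma leibniz_ideal_uminus: "p \<in> leibniz_ideal \<Longrightarrow> - p \<in> leibniz_ideal"
proof -
  interpret vector_space na_scale by (rule na_scale_vector_space)
  show "p \<in> leibniz_ideal \<Longrightarrow> - p \<in> leibniz_ideal"
    using leibniz_ideal.scale[of p "-1"] by simp
qed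

lemma leibniz_rel_equivp: "equivp leibniz_rel"
proof (rule equivpI)
  show "reflp leibniz_rel"
    by (rule reflpI) (simp add: leibniz_rel_def leibniz_ideal.zero)
  show "symp leibniz_rel"
    by (rule sympI) (use leibniz_ideal_uminus in \<open>fastforce simp: leibniz_rel_def\<close>)
  show "transp leibniz_rel"
    by (rule transpI) (use leibniz_ideal.add in \<open>fastforce simp: leibniz_rel_def\<close>)
qed

quotient_type (overloaded) 'k free_leibniz = "('k::field) nonassoc_poly" / leibniz_rel
  by (rule leibniz_rel_equivp)

instantiation free_leibniz :: (field) ab_group_add
begin

lift_definition zero_free_leibniz :: "'a free_leibniz" is 0 .

lift_definition plus_free_leibniz :: "'a free_leibniz \<Rightarrow> 'a free_leibniz \<Rightarrow> 'a free_leibniz" is "(+)"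
  unfolding leibniz_rel_def by (metis add_diff_add leibniz_ideal.add)

lift_definition uminus_free_leibniz :: "'a free_leibniz \<Rightarrow> 'a free_leibniz" is uminus
  unfolding leibniz_rel_def using leibniz_ideal_uminus by fastforce

lift_definition minus_free_leibniz :: "'a free_leibniz \<Rightarrow> 'a free_leibniz \<Rightarrow> 'a free_leibniz" is "(-)"
proof -
  fix p p' q q' :: "'a nonassoc_poly"
  assume "leibniz_rel p p'" "leibniz_rel q q'"
  then have "(p - p') + - (q - q') \<in> leibniz_ideal"
    unfolding leibniz_rel_def by (blast intro: leibniz_ideal.add leibniz_ideal_uminus)
  then show "leibniz_rel (p - q) (p' - q')"
    unfolding leibniz_rel_def by (simp add: algebra_simps)
qed

instance
  by (standard; transfer) (simp_all add: algebra_simps equivp_reflp[OF leibniz_rel_equivp])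

end

lift_definition fl_scale :: "'k::field \<Rightarrow> 'k free_leibniz \<Rightarrow> 'k free_leibniz" is na_scale
proof -
  interpret vector_space na_scale by (rule na_scale_vector_space)
  show "leibniz_rel p q \<Longrightarrow> leibniz_rel (na_scale c p) (na_scale c q)"
    for c :: 'k and p q
    using leibniz_ideal.scale[of "p - q" c] by (simp add: leibniz_rel_def scale_right_diff_distrib)
qed

lift_definition fl_mult :: "'k::field free_leibniz \<Rightarrow> 'k free_leibniz \<Rightarrow> 'k free_leibniz" is na_mult
proof -
  interpret nonassoc_algebra na_scale na_mult by (rule na_nonassoc_algebra)
  fix p p' q q' :: "'k nonassoc_poly"
  assume "leibniz_rel p p'" "leibniz_rel q q'"
  then have "na_mult (p - p') q + na_mult p' (q - q') \<in> leibniz_ideal"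
    unfolding leibniz_rel_def by (blast intro: leibniz_ideal.intros)
  then show "leibniz_rel (na_mult p q) (na_mult p' q')"
    unfolding leibniz_rel_def by (simp add: mult_diff_left mult_diff_right)
qed

lift_definition fl_var :: "nat \<Rightarrow> 'k::field free_leibniz" is
  "\<lambda>i. Poly_Mapping.single (Var i) 1" .

lemma fl_leibniz_algebra: "leibniz_algebra (fl_scale :: 'k::field \<Rightarrow> _) fl_mult"
proof -
  interpret nonassoc_algebra na_scale na_mult by (rule na_nonassoc_algebra)
  have eq: "p = q \<Longrightarrow> leibniz_rel p q" for p q :: "'k::field nonassoc_poly"
    using equivp_reflp[OF leibniz_rel_equivp] by blast
  show ?thesis
  proof
    show "fl_scale a (x + y) = fl_scale a x + fl_scale a y" for a :: 'k and x y
      by transfer (rule eq, rule scale_right_distrib)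
    show "fl_scale (a + b) x = fl_scale a x + fl_scale b x" for a b :: 'k and x
      by transfer (rule eq, rule scale_left_distrib)
    show "fl_scale a (fl_scale b x) = fl_scale (a * b) x" for a b :: 'k and x
      by transfer (rule eq, rule scale_scale)
    show "fl_scale 1 x = x" for x :: "'k free_leibniz"
      by transfer (rule eq, rule scale_one)
    show "fl_mult (x + y) z = fl_mult x z + fl_mult y z" for x y z :: "'k free_leibniz"
      by transfer (rule eq, rule mult_add_left)
    show "fl_mult x (y + z) = fl_mult x y + fl_mult x z" for x y z :: "'k free_leibniz"
      by transfer (rule eq, rule mult_add_right)
    show "fl_mult (fl_scale c x) y = fl_scale c (fl_mult x y)" for c :: 'k and x y
      by transfer (rule eq, rule mult_scale_left)
    show "fl_mult x (fl_scale c y) = fl_scale c (fl_mult x y)" for c :: 'k and x y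
      by transfer (rule eq, rule mult_scale_right)
    show "fl_mult x (fl_mult y z) = fl_mult (fl_mult x y) z - fl_mult (fl_mult x z) y"
      for x y z :: "'k free_leibniz"
      by transfer (unfold leibniz_rel_def, rule leibniz_ideal.generator)
  qed
qed

text \<open>The value \<open>f(a\<^sub>0, a\<^sub>1, \<dots>)\<close>, defined through the universal property, which is
  \<open>ex1_fl_hom\<close> below. Only finitely many of the \<open>a\<^sub>i\<close> matter for a given \<open>f\<close>.\<close>

definition fl_eval ::
  "('k::field \<Rightarrow> 'a::ab_group_add \<Rightarrow> 'a) \<Rightarrow> ('a \<Rightarrow> 'a \<Rightarrow> 'a) \<Rightarrow> (nat \<Rightarrow> 'a) \<Rightarrow>
   'k free_leibniz \<Rightarrow> 'a" where
  "fl_eval smul mul a =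
     (THE h. algebra_hom fl_scale fl_mult smul mul h \<and> (\<forall>i. h (fl_var i) = a i))"

definition identities ::
  "('k::field \<Rightarrow> 'a::ab_group_add \<Rightarrow> 'a) \<Rightarrow> ('a \<Rightarrow> 'a \<Rightarrow> 'a) \<Rightarrow> 'k free_leibniz set" where
  "identities smul mul = {f. \<forall>a. fl_eval smul mul a f = 0}"

lemma (in leibniz_algebra) na_eval_leibniz_ideal:
  "p \<in> leibniz_ideal \<Longrightarrow> na_eval smul mul a p = 0"
proof (induction rule: leibniz_ideal.induct)
  case (generator p q r)
  show ?case by (simp add: na_eval_diff na_eval_mult leibniz)
qed (simp_all add: na_eval_zero na_eval_add na_eval_scale na_eval_mult
    mult_zero_left mult_zero_right)

lemma na_mult_single_one:
  "na_mult (Poly_Mapping.single t 1) (Poly_Mapping.single u 1) =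
   (Poly_Mapping.single (Prod t u) 1 :: 'k::field nonassoc_poly)"
  by (simp add: na_mult_def)

lemma nonassoc_poly_expand:
  "p = (\<Sum>t\<in>Poly_Mapping.keys p. na_scale (Poly_Mapping.lookup p t) (Poly_Mapping.single t 1))"
  by (rule poly_mapping_eqI)
    (simp add: lookup_sum lookup_single_if if_distrib[of "(*) _"] in_keys_iff cong: if_cong)

lemma fl_hom_eq_na_eval:
  assumes "algebra_hom fl_scale fl_mult smul mul h" "\<And>i. h (fl_var i) = a i"
  shows "h (abs_free_leibniz p) = na_eval smul mul a p"
proof -
  interpret Vector_Spaces.linear fl_scale smul h
    using assms(1) by (simp add: algebra_hom_def)
  have hm: "h (fl_mult x y) = mul (h x) (h y)" for x y
    using assms(1) by (simp add: algebra_hom_def)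
  have mon: "h (abs_free_leibniz (Poly_Mapping.single t 1)) = monomial_eval mul a t" for t
  proof (induction t)
    case (Var i)
    then show ?case using assms(2)[of i] by (simp add: fl_var.abs_eq)
  next
    case (Prod t u)
    then show ?case by (metis hm fl_mult.abs_eq na_mult_single_one monomial_eval.simps(2))
  qed
  have abs_sum: "abs_free_leibniz (sum f S) = (\<Sum>t\<in>S. abs_free_leibniz (f t))"
    for f :: "monomial \<Rightarrow> _" and S
    by (induction S rule: infinite_finite_induct)
      (simp_all add: zero_free_leibniz.abs_eq plus_free_leibniz.abs_eq[symmetric])
  show ?thesis
    by (subst nonassoc_poly_expand)
      (simp add: abs_sum fl_scale.abs_eq[symmetric] sum scale mon na_eval_def)
qed

context leibniz_algebra
begin

lemma ex1_fl_hom: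
  "\<exists>!h. algebra_hom fl_scale fl_mult smul mul h \<and> (\<forall>i. h (fl_var i) = a i)"
proof (rule ex_ex1I)
  interpret F: leibniz_algebra "fl_scale :: 'k \<Rightarrow> _" fl_mult by (rule fl_leibniz_algebra)
  define h where "h f = na_eval smul mul a (rep_free_leibniz f)" for f
  have h: "h (abs_free_leibniz p) = na_eval smul mul a p" for p
  proof -
    have "leibniz_rel (rep_free_leibniz (abs_free_leibniz p)) p"
      using Quotient3_rep_abs[OF Quotient3_free_leibniz]
        equivp_reflp[OF leibniz_rel_equivp] by blast
    then show ?thesis
      unfolding h_def leibniz_rel_def using na_eval_leibniz_ideal na_eval_diff by fastforce
  qed
  have "h (x + y) = h x + h y" for x y
    by (induction x; induction y) (simp add: plus_free_leibniz.abs_eq h na_eval_add)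
  moreover have "h (fl_scale c x) = smul c (h x)" for c x
    by (induction x) (simp add: fl_scale.abs_eq h na_eval_scale)
  moreover have "h (fl_mult x y) = mul (h x) (h y)" for x y
    by (induction x; induction y) (simp add: fl_mult.abs_eq h na_eval_mult)
  moreover have "h (fl_var i) = a i" for i
    by (simp add: fl_var.abs_eq h na_eval_single)
  ultimately have "algebra_hom fl_scale fl_mult smul mul h \<and> (\<forall>i. h (fl_var i) = a i)"
    unfolding algebra_hom_def
    by (simp add: Vector_Spaces.linear_iff F.vector_space_axioms vector_space_axioms)
  then show "\<exists>h. algebra_hom fl_scale fl_mult smul mul h \<and> (\<forall>i. h (fl_var i) = a i)" by blast
next
  fix h h'
  assume "algebra_hom fl_scale fl_mult smul mul h \<and> (\<forall>i. h (fl_var i) = a i)"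
    and "algebra_hom fl_scale fl_mult smul mul h' \<and> (\<forall>i. h' (fl_var i) = a i)"
  then have "h (abs_free_leibniz p) = h' (abs_free_leibniz p)" for p
    using fl_hom_eq_na_eval[of smul mul h a p] fl_hom_eq_na_eval[of smul mul h' a p] by simp
  then have "h f = h' f" for f
    by (induction f)
  then show "h = h'" ..
qed

lemma fl_eval_hom: "algebra_hom fl_scale fl_mult smul mul (fl_eval smul mul a)"
  and fl_eval_var: "fl_eval smul mul a (fl_var i) = a i"
  using theI'[OF ex1_fl_hom[of a]] by (auto simp: fl_eval_def)

lemma fl_eval_abs: "fl_eval smul mul a (abs_free_leibniz p) = na_eval smul mul a p"
  by (rule fl_hom_eq_na_eval[OF fl_eval_hom fl_eval_var])

end

end

theory Submission
  imports Defs
begin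

text \<open>On \<open>K\<^sup>3\<close> let \<open>x y = (x\<^sub>1 y\<^sub>1 + e x\<^sub>2 y\<^sub>2) e\<^sub>3\<close>. All triple products vanish, so a polynomial
  is evaluated through its linear part \<open>L\<close> and its quadratic part \<open>Q\<close>, and the value at \<open>a\<close> has the
  coordinates \<open>L(a\<^sub>1)\<close>, \<open>L(a\<^sub>2)\<close> and \<open>L(a\<^sub>3) + Q(a\<^sub>1) + e Q(a\<^sub>2)\<close>. Hence it is an identity iff \<open>L\<close> and
  \<open>Q\<close> vanish as functions on \<open>K\<close>, whatever \<open>e\<close> is. The algebras for \<open>e = 0\<close> and \<open>e = 1\<close> are not
  isomorphic since their annihilators have dimensions 2 and 1.\<close>

definition form_mul :: "'k::field \<Rightarrow> 'k^3 \<Rightarrow> 'k^3 \<Rightarrow> 'k^3" where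
  "form_mul e x y = axis 3 (x$1 * y$1 + e * (x$2 * y$2))"

lemma form_mul_nth [simp]:
  "form_mul e x y $ 1 = 0" "form_mul e x y $ 2 = 0"
  "form_mul e x y $ 3 = x$1 * y$1 + e * (x$2 * y$2)"
  by (simp_all add: form_mul_def axis_def)

lemma leibniz_algebra_form_mul: "leibniz_algebra (*s) (form_mul e)"
  by unfold_locales (simp_all add: vec_eq_iff forall_3 algebra_simps)

lemma metabelian_form_mul: "metabelian (form_mul e)"
  by (simp add: metabelian_def vec_eq_iff forall_3)

lemma not_lie_algebra_form_mul: "\<not> lie_algebra (*s) (form_mul e)"
proof
  assume "lie_algebra (*s) (form_mul e)"
  then have "form_mul e (axis 1 1) (axis 1 1) $ 3 = 0"
    by (simp add: lie_algebra.alternating)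
  then show False by (simp add: axis_def)
qed

text \<open>Evaluation in \<open>K\<close> with the zero product, so that only single variables
  survive.\<close>

definition linear_value :: "(nat \<Rightarrow> 'k::field) \<Rightarrow> monomial \<Rightarrow> 'k" where
  "linear_value = monomial_eval (\<lambda>_ _. 0)"

text \<open>Nonzero at most on products of two variables, since \<open>linear_value\<close> kills
  every longer factor.\<close>

definition quadratic_value :: "(nat \<Rightarrow> 'k::field) \<Rightarrow> monomial \<Rightarrow> 'k" where
  "quadratic_value s t =
    (case t of Var _ \<Rightarrow> 0 | Prod u v \<Rightarrow> linear_value s u * linear_value s v)"

text \<open>A factor enters a product only through its first two coordinates, and these are linear
  values by induction.\<close>

lemma monomial_eval_form_mul:
  shows "monomial_eval (form_mul e) a t $ 1 = linear_value (\<lambda>i. a i $ 1) t"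
    and "monomial_eval (form_mul e) a t $ 2 = linear_value (\<lambda>i. a i $ 2) t"
    and "monomial_eval (form_mul e) a t $ 3 = linear_value (\<lambda>i. a i $ 3) t
      + (quadratic_value (\<lambda>i. a i $ 1) t + e * quadratic_value (\<lambda>i. a i $ 2) t)"
  by (induction t) (simp_all add: linear_value_def quadratic_value_def)

lemma linear_value_zero [simp]: "linear_value (\<lambda>i. 0) t = 0"
  by (cases t) (simp_all add: linear_value_def)

lemma quadratic_value_zero [simp]: "quadratic_value (\<lambda>i. 0) t = 0"
  by (cases t) (simp_all add: quadratic_value_def)

text \<open>The weights \<open>linear_value s\<close> and \<open>quadratic_value s\<close> give the
  values of \<open>L\<close> and \<open>Q\<close> at \<open>s\<close>.\<close>

definition weighted_sum :: "(monomial \<Rightarrow> 'k) \<Rightarrow> 'k::field nonassoc_poly \<Rightarrow> 'k" where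
  "weighted_sum w p = (\<Sum>t\<in>Poly_Mapping.keys p. Poly_Mapping.lookup p t * w t)"

lemma na_eval_form_mul:
  shows "na_eval (*s) (form_mul e) a p $ 1 = weighted_sum (linear_value (\<lambda>i. a i $ 1)) p"
    and "na_eval (*s) (form_mul e) a p $ 2 = weighted_sum (linear_value (\<lambda>i. a i $ 2)) p"
    and "na_eval (*s) (form_mul e) a p $ 3 = weighted_sum (linear_value (\<lambda>i. a i $ 3)) p
      + (weighted_sum (quadratic_value (\<lambda>i. a i $ 1)) p
        + e * weighted_sum (quadratic_value (\<lambda>i. a i $ 2)) p)"
  by (simp_all add: na_eval_def weighted_sum_def monomial_eval_form_mul
      distrib_left sum.distrib sum_distrib_left mult.left_commute)

lemma form_mul_identity_iff:
  "(\<forall>a. na_eval (*s) (form_mul e) a p = 0) \<longleftrightarrow>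
    (\<forall>s. weighted_sum (linear_value s) p = 0 \<and> weighted_sum (quadratic_value s) p = 0)"
  (is "?L \<longleftrightarrow> ?R")
proof
  assume L: ?L
  show ?R
  proof
    fix s :: "nat \<Rightarrow> 'a"
    \<comment> \<open>On the first axis the term with \<open>e\<close> drops out: coordinate 1 of
      the value is \<open>L\<close> at \<open>s\<close>, coordinate 3 is \<open>Q\<close> at
      \<open>s\<close>.\<close>
    define a where "a i = (axis 1 (s i) :: 'a^3)" for i
    have [simp]: "a i $ 1 = s i" "a i $ 2 = 0" "a i $ 3 = 0" for i
      by (simp_all add: a_def axis_def)
    have "na_eval (*s) (form_mul e) a p $ 1 = 0" "na_eval (*s) (form_mul e) a p $ 3 = 0"
      using L by simp_all
    then show "weighted_sum (linear_value s) p = 0 \<and> weighted_sum (quadratic_value s) p = 0"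
      unfolding na_eval_form_mul by (simp add: weighted_sum_def)
  qed
qed (simp add: vec_eq_iff forall_3 na_eval_form_mul)

text \<open>The criterion \<open>form_mul_identity_iff\<close> does not involve \<open>e\<close>;
  the induction on \<open>f\<close> picks a representing polynomial.\<close>

lemma identities_form_mul: "identities (*s) (form_mul e) = identities (*s) (form_mul e')"
proof -
  have "f \<in> identities (*s) (form_mul e) \<longleftrightarrow> f \<in> identities (*s) (form_mul e')" for f
    by (induction f)
      (simp add: identities_def leibniz_algebra.fl_eval_abs[OF leibniz_algebra_form_mul]
        form_mul_identity_iff)
  then show ?thesis by blast
qed

lemma not_isomorphic_form_mul:
  "\<not> algebras_isomorphic (*s) (form_mul (0::'k::field)) (*s) (form_mul 1)"
proof
  assume "algebras_isomorphic (*s) (form_mul (0::'k)) (*s) (form_mul 1)"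
  then obtain h :: "'k^3 \<Rightarrow> 'k^3" where lin: "Vector_Spaces.linear (*s) (*s) h"
    and hm: "\<And>x y. h (form_mul 0 x y) = form_mul 1 (h x) (h y)" and "bij h"
    by (auto simp: algebras_isomorphic_def algebra_hom_def)
  interpret h: Vector_Spaces.linear "(*s)" "(*s)" h by (rule lin)
  have inj: "x = 0" if "h x = 0" for x
    using that \<open>bij h\<close> by (metis bij_pointE h.zero)
  have ann: "h x $ 1 = 0 \<and> h x $ 2 = 0" if "x $ 1 = 0" for x
  proof -
    \<comment> \<open>Here \<open>x\<close> annihilates the source from the left, and
      \<open>h\<close> is onto, so \<open>h x\<close> annihilates the target. For
      \<open>e = 1\<close>, multiplying by the first two basis vectors reads off both coordinates of
      \<open>h x\<close>.\<close>
    have "form_mul 1 (h x) z = 0" for z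
    proof -
      obtain y where "z = h y" using \<open>bij h\<close> by (metis bij_pointE)
      moreover have "form_mul 0 x y = 0"
        using that by (simp add: vec_eq_iff forall_3)
      ultimately show ?thesis by (metis hm h.zero)
    qed
    then have "form_mul 1 (h x) (axis 1 1) $ 3 = 0" "form_mul 1 (h x) (axis 2 1) $ 3 = 0"
      by simp_all
    then show ?thesis by (simp add: axis_def)
  qed
  define u v :: "'k^3" where "u = axis 2 1" and "v = axis 3 1"
  have u: "u $ 1 = 0" and v: "v $ 1 = 0" by (simp_all add: u_def v_def axis_def)
  \<comment> \<open>Both \<open>h u\<close> and \<open>h v\<close> lie on the third axis, hence are
    dependent; these coefficients cancel the third coordinate.\<close>
  have "h (h v $ 3 *s u - h u $ 3 *s v) = 0"
    using ann[OF u] ann[OF v] by (simp add: h.diff h.scale vec_eq_iff forall_3)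
  then have "h v $ 3 *s u - h u $ 3 *s v = 0" by (rule inj)
  then have "(h v $ 3 *s u - h u $ 3 *s v) $ 3 = 0" by simp
  then have "h u $ 3 = 0" by (simp add: u_def v_def axis_def)
  then have "h u = 0" using ann[OF u] by (simp add: vec_eq_iff forall_3)
  then have "u $ 2 = 0" using inj by fastforce
  then show False by (simp add: u_def axis_def)
qed

theorem mainTheorem1:
  shows "\<exists>(smulA :: 'k::field \<Rightarrow> 'k^3 \<Rightarrow> 'k^3) mulA (smulB :: 'k \<Rightarrow> 'k^3 \<Rightarrow> 'k^3) mulB.
    leibniz_algebra smulA mulA \<and> leibniz_algebra smulB mulB \<and>
    vector_space.dim smulA UNIV = 3 \<and> vector_space.dim smulB UNIV = 3 \<and>
    metabelian mulA \<and> metabelian mulB \<and>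
    \<not> lie_algebra smulA mulA \<and> \<not> lie_algebra smulB mulB \<and>
    \<not> algebras_isomorphic smulA mulA smulB mulB \<and>
    identities smulA mulA = identities smulB mulB"
proof (intro exI conjI)
  show "leibniz_algebra (*s) (form_mul (0::'k))" "leibniz_algebra (*s) (form_mul (1::'k))"
    by (rule leibniz_algebra_form_mul)+
  show "vec.dim (UNIV :: ('k^3) set) = 3" "vec.dim (UNIV :: ('k^3) set) = 3"
    by (simp_all only: vec_dim_card) simp_all
  show "metabelian (form_mul (0::'k))" "metabelian (form_mul (1::'k))"
    by (rule metabelian_form_mul)+
  show "\<not> lie_algebra (*s) (form_mul (0::'k))" "\<not> lie_algebra (*s) (form_mul (1::'k))"
    by (rule not_lie_algebra_form_mul)+
  show "\<not> algebras_isomorphic (*s) (form_mul (0::'k)) (*s) (form_mul 1)"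
    by (rule not_isomorphic_form_mul)
  show "identities (*s) (form_mul (0::'k)) = identities (*s) (form_mul 1)"
    by (rule identities_form_mul)
qed

end
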